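(* There is a non-mixing shift space $Y$ with the strong property $P$.
   Context: Let $\mathcal A$ be a finite alphabet with at least two elements, and let $\mathcal A^{\mathbb Z}$ carry the product topology. A shift space is a closed shift-invariant subset $X\subset\mathcal A^{\mathbb Z}$; $\mathcal B(X)$ is the set of all finite words occurring in points of $X$, and $\mathcal B_n(X)$ the set of those of length $n$. All shift spaces are assumed transitive: for all $u,v\in\mathcal B(X)$ there is $w\in\mathcal B(X)$ with $uwv\in\mathcal B(X)$. A shift space $X$ is mixing if for all $u,v\in\mathcal B(X)$ there is $N>0$ such that for every $n>N$ there is $w\in\mathcal B_n(X)$ with $uwv\in\mathcal B(X)$. $X$ has the strong property $P$ if for any $k\ge2$ and any words $u_1,\dots,u_k\in\mathcal B(X)$ with $|u_1|=\dots=|u_k|$ there is $n\in\mathbb N$ such that for any $N\in\mathbb N$ and any function $\varphi\colon\{1,\dots,N\}\to\{1,\dots,k\}$ there are words $w_1,\dots,w_{N-1}\in\mathcal B_n(X)$ such that $u_{\varphi(1)}w_1u_{\varphi(2)}w_2\cdots u_{\varphi(N-1)}w_{N-1}u_{\varphi(N)}\in\mathcal B(X)$. *)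

theory Defs
  imports "HOL-Analysis.Function_Topology"
begin

text \<open>The alphabet is a set \<open>A\<close> of symbols, and finite words are lists.\<close>

definition full_shift :: "'a set \<Rightarrow> (int \<Rightarrow> 'a) topology" where
  "full_shift A = product_topology (\<lambda>_. discrete_topology A) UNIV"

definition shift_map :: "(int \<Rightarrow> 'a) \<Rightarrow> (int \<Rightarrow> 'a)" where
  "shift_map x = (\<lambda>i. x (i + 1))"

definition shift_space :: "'a set \<Rightarrow> (int \<Rightarrow> 'a) set \<Rightarrow> bool" where
  "shift_space A X \<longleftrightarrow> closedin (full_shift A) X \<and> shift_map ` X = X"

definition language :: "(int \<Rightarrow> 'a) set \<Rightarrow> 'a list set" where
  "language X = {map (\<lambda>j. x (i + int j)) [0..<n] |x i n. x \<in> X}"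

definition language_of_length :: "(int \<Rightarrow> 'a) set \<Rightarrow> nat \<Rightarrow> 'a list set" where
  "language_of_length X n = {w \<in> language X. length w = n}"

definition transitive_shift :: "(int \<Rightarrow> 'a) set \<Rightarrow> bool" where
  "transitive_shift X \<longleftrightarrow>
     (\<forall>u \<in> language X. \<forall>v \<in> language X. \<exists>w \<in> language X. u @ w @ v \<in> language X)"

definition mixing_shift :: "(int \<Rightarrow> 'a) set \<Rightarrow> bool" where
  "mixing_shift X \<longleftrightarrow>
     (\<forall>u \<in> language X. \<forall>v \<in> language X. \<exists>N>0. \<forall>n>N.
        \<exists>w \<in> language_of_length X n. u @ w @ v \<in> language X)"

text \<open>
  Here the natural numbers start at 1. This matters only for \<open>N\<close>, as the concatenated word is
  meaningful only for \<open>N \<ge> 1\<close>: if \<open>n = 0\<close> were possible for some words \<open>u\<close>, then so would be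
  \<open>n = length (u 1)\<close> (or \<open>n = 1\<close>, if the words are empty).
\<close>

definition strong_property_P :: "(int \<Rightarrow> 'a) set \<Rightarrow> bool" where
  "strong_property_P X \<longleftrightarrow>
     (\<forall>k\<ge>2. \<forall>u :: nat \<Rightarrow> 'a list.
        (\<forall>i\<in>{1..k}. u i \<in> language X) \<and> (\<forall>i\<in>{1..k}. \<forall>j\<in>{1..k}. length (u i) = length (u j)) \<longrightarrow>
        (\<exists>n\<ge>1. \<forall>N\<ge>1. \<forall>\<phi> \<in> {1..N} \<rightarrow> {1..k}.
           \<exists>w. (\<forall>i\<in>{1..<N}. w i \<in> language_of_length X n) \<and>
               concat (map (\<lambda>i. u (\<phi> i) @ w i) [1..<N]) @ u (\<phi> N) \<in> language X))"

end

theory Submission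
  imports Defs
begin

text \<open>
  Fix two symbols \<open>a \<noteq> b\<close> and let \<open>Y\<close> be the spacing shift of all points over \<open>{a, b}\<close> in which no
  two occurrences of \<open>b\<close> are at a distance that is a power of 3. The forbidden distances are
  unbounded, so \<open>Y\<close> is not mixing. On the other hand, if words of length at most \<open>m\<close> are written on
  a background of \<open>a\<close>'s starting at multiples of \<open>2 * 3 ^ m\<close>, then symbols of different words have
  a distance \<open>2 * 3 ^ m * q + r\<close> with \<open>q \<ge> 1\<close> and \<open>\<bar>r\<bar> < m\<close>, and this is never a power \<open>3 ^ k\<close>:
  for \<open>k < m\<close> it is too large, and for \<open>k \<ge> m\<close> divisibility by \<open>3 ^ m\<close> forces \<open>r = 0\<close>, but
  \<open>3 ^ k\<close> is odd.
\<close>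

definition spacing_shift :: "'a \<Rightarrow> 'a \<Rightarrow> (int \<Rightarrow> 'a) set" where
  "spacing_shift a b =
     {x. (\<forall>i. x i \<in> {a, b}) \<and> (\<forall>i k. x i = b \<longrightarrow> x (i + 3 ^ k) \<noteq> b)}"

text \<open>Indexing the words by all integers yields a bi-infinite point at once; to embed finitely
  many words, the remaining blocks receive any harmless filler.\<close>

definition place_words :: "'a \<Rightarrow> nat \<Rightarrow> (int \<Rightarrow> 'a list) \<Rightarrow> int \<Rightarrow> 'a" where
  "place_words a L v i =
     (let s = i div int L; j = nat (i mod int L) in if j < length (v s) then v s ! j else a)"

section \<open>Arithmetic of powers of 3\<close>

lemma less_three_power: "m < 3 ^ m" for m :: nat
  by (induction m) auto

lemma power_of_three_not_near_multiple:
  fixes q r :: int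
  assumes "1 \<le> q" "\<bar>r\<bar> < int m"
  shows "int (2 * 3 ^ m) * q + r \<noteq> 3 ^ k"
proof
  assume eq: "int (2 * 3 ^ m) * q + r = 3 ^ k"
  \<comment> \<open>This weaker bound suffices for both cases: it keeps the left side of
    \<open>eq\<close> above \<open>3 ^ m\<close>, and it leaves 0 as the only multiple of
    \<open>3 ^ m\<close> that \<open>r\<close> can be.\<close>
  have r: "\<bar>r\<bar> < 3 ^ m"
    using assms(2) less_three_power[of m]
    by (metis of_nat_less_iff of_nat_numeral of_nat_power order.strict_trans)
  show False
  proof (cases "k < m")
    case True
    have "(3::int) ^ m \<le> 3 ^ m * q"
      using assms(1) by simp
    moreover have "2 * (3 ^ m * q) + r = 3 ^ k"
      using eq by simp
    moreover have "(3::int) ^ k \<le> 3 ^ m"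
      using True by (intro power_increasing) auto
    ultimately show False
      using r assms(1) by linarith
  next
    case False
    then have "(3::int) ^ m dvd 3 ^ k"
      by (simp add: le_imp_power_dvd)
    moreover have "r = 3 ^ k - 3 ^ m * (2 * q)"
      using eq by simp
    ultimately have "3 ^ m dvd r"
      by (metis dvd_diff dvd_triv_left)
    then have "r = 0"
      using r dvd_imp_le_int[of r "3 ^ m"] by (cases "r = 0") simp_all
    then have "even ((3::int) ^ k)"
      using eq[symmetric] by simp
    then show False
      by simp
  qed
qed

section \<open>Closedness and shift invariance\<close>

text \<open>Each defining condition involves at most two coordinates, so it is a finite union of
  preimages of closed subsets of the discrete alphabet under projections.\<close>

lemma closedin_spacing_shift:
  assumes "a \<in> A" "b \<in> A"
  shows "closedin (full_shift A) (spacing_shift a b)"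
proof -
  have cyl: "closedin (full_shift A) {x \<in> topspace (full_shift A). x i \<in> B}"
    if "B \<subseteq> A" for i B
    unfolding full_shift_def
    by (rule closedin_continuous_map_preimage[OF continuous_map_product_projection])
       (use that in auto)
  have "spacing_shift a b =
      (\<Inter>i. {x \<in> topspace (full_shift A). x i \<in> {a, b}}) \<inter>
      (\<Inter>i. \<Inter>k. {x \<in> topspace (full_shift A). x i \<in> A - {b}} \<union>
               {x \<in> topspace (full_shift A). x (i + 3 ^ k) \<in> A - {b}})"
    using assms by (fastforce simp: spacing_shift_def full_shift_def topspace_product_topology)
  also have "closedin (full_shift A) \<dots>"
    using assms by (intro closedin_Int closedin_INT closedin_Un cyl) auto
  finally show ?thesis .
qed

lemma shift_map_spacing_shift: "shift_map ` spacing_shift a b = spacing_shift a b"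
proof (intro equalityI subsetI)
  fix y assume "y \<in> shift_map ` spacing_shift a b"
  then obtain x where x: "x \<in> spacing_shift a b" "y = shift_map x"
    by auto
  have "x (i + 1) = b \<longrightarrow> x (i + 1 + 3 ^ k) \<noteq> b" for i k
    using x(1) by (simp add: spacing_shift_def)
  then show "y \<in> spacing_shift a b"
    using x by (auto simp: spacing_shift_def shift_map_def algebra_simps)
next
  fix x assume x: "x \<in> spacing_shift a b"
  have "x (i - 1) = b \<longrightarrow> x (i - 1 + 3 ^ k) \<noteq> b" for i k
    using x by (simp add: spacing_shift_def)
  then have "(\<lambda>i. x (i - 1)) \<in> spacing_shift a b"
    using x by (auto simp: spacing_shift_def algebra_simps)
  moreover have "x = shift_map (\<lambda>i. x (i - 1))"
    by (simp add: shift_map_def)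
  ultimately show "x \<in> shift_map ` spacing_shift a b"
    by blast
qed

lemma shift_space_spacing_shift:
  "a \<in> A \<Longrightarrow> b \<in> A \<Longrightarrow> shift_space A (spacing_shift a b)"
  by (simp add: shift_space_def closedin_spacing_shift shift_map_spacing_shift)

section \<open>Words of the spacing shift\<close>

lemma map_in_languageI: "x \<in> X \<Longrightarrow> map (\<lambda>j. x (i + int j)) [0..<n] \<in> language X"
  unfolding language_def by blast

lemma replicate_in_language_spacing_shift:
  assumes "a \<noteq> b"
  shows "replicate n a \<in> language (spacing_shift a b)"
proof -
  have "(\<lambda>_. a) \<in> spacing_shift a b"
    using assms by (simp add: spacing_shift_def)
  from map_in_languageI[OF this, of n] show ?thesis
    by (simp add: map_replicate_const)
qed

text \<open>Used both to control pairs inside a single placed word and to refute mixing.\<close>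

lemma language_spacing_shiftD:
  assumes "w \<in> language (spacing_shift a b)"
  shows "set w \<subseteq> {a, b}"
    and "p + 3 ^ k < length w \<Longrightarrow> w ! p = b \<Longrightarrow> w ! (p + 3 ^ k) \<noteq> b"
proof -
  obtain x i n where x: "x \<in> spacing_shift a b" and w: "w = map (\<lambda>j. x (i + int j)) [0..<n]"
    using assms unfolding language_def by blast
  show "set w \<subseteq> {a, b}"
    using x w by (auto simp: spacing_shift_def)
  have "x (i + int p) = b \<longrightarrow> x (i + int p + 3 ^ k) \<noteq> b"
    using x by (simp add: spacing_shift_def)
  then show "w ! (p + 3 ^ k) \<noteq> b" if "p + 3 ^ k < length w" "w ! p = b"
    using that w by (auto simp: algebra_simps)
qed

section \<open>Placing words on a background\<close>

text \<open>Two symbols \<open>b\<close> at a forbidden distance cannot lie in one word, which is in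
  the language, nor in different blocks, where their offsets differ by less than \<open>m\<close>
  and \<open>power_of_three_not_near_multiple\<close> applies.\<close>

lemma place_words_in_spacing_shift:
  assumes "a \<noteq> b"
    and lang: "\<And>s. v s \<in> language (spacing_shift a b)"
    and len: "\<And>s. length (v s) \<le> m"
  shows "place_words a (2 * 3 ^ m) v \<in> spacing_shift a b"
proof -
  define L :: nat where "L = 2 * 3 ^ m"
  have "m < L"
    using less_three_power[of m] by (simp add: L_def)
  \<comment> \<open>Every \<open>b\<close> comes from a placed word, because the filler
    \<open>a\<close> differs from \<open>b\<close>.\<close>
  have symbol: "\<exists>s j. i = int L * s + int j \<and> j < length (v s) \<and> v s ! j = b"
    if "place_words a L v i = b" for i
  proof (intro exI conjI)
    show "i = int L * (i div int L) + int (nat (i mod int L))"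
      using \<open>m < L\<close> by simp
  qed (use that \<open>a \<noteq> b\<close> in \<open>auto simp: place_words_def Let_def split: if_splits\<close>)
  have "place_words a L v (i + 3 ^ k) \<noteq> b" if i: "place_words a L v i = b" for i k
  proof
    assume "place_words a L v (i + 3 ^ k) = b"
    then obtain t j' where t: "i + 3 ^ k = int L * t + int j'" "j' < length (v t)" "v t ! j' = b"
      using symbol by blast
    obtain s j where s: "i = int L * s + int j" "j < length (v s)" "v s ! j = b"
      using symbol[OF i] by blast
    have eq: "int L * (t - s) + (int j' - int j) = 3 ^ k"
      using s(1) t(1) by (simp add: algebra_simps)
    have r: "\<bar>int j' - int j\<bar> < int m"
      using s(2) t(2) len[of s] len[of t] by linarith
    consider "t = s" | "1 \<le> t - s" | "t - s \<le> -1"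
      by linarith
    then show False
    proof cases
      case 1
      then have "int j' = int (j + 3 ^ k)"
        using eq by simp
      then have "j' = j + 3 ^ k"
        by (simp only: of_nat_eq_iff)
      then show False
        using 1 s t language_spacing_shiftD(2)[OF lang, of j k s] by simp
    next
      case 2
      then show False
        using power_of_three_not_near_multiple[OF _ r] eq by (simp add: L_def)
    next
      case 3
      \<comment> \<open>The position further right cannot lie in an earlier block: as
        \<open>m < L\<close>, the left side of \<open>eq\<close> would be negative.\<close>
      then have "int L * (t - s) \<le> int L * (-1)"
        by (intro mult_left_mono) auto
      moreover have "(0::int) < 3 ^ k"
        by simp
      ultimately show False
        using eq r \<open>m < L\<close> by linarith
    qed
  qed
  moreover have "place_words a L v i \<in> {a, b}" for i
    using language_spacing_shiftD(1)[OF lang[of "i div int L"]]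
    by (auto simp: place_words_def Let_def dest: nth_mem)
  ultimately show ?thesis
    by (simp add: spacing_shift_def L_def)
qed

lemma place_words_at:
  assumes "j < L"
  shows "place_words a L v (int L * s + int j) = (if j < length (v s) then v s ! j else a)"
  using assms by (simp add: place_words_def)

lemma map_place_words_prefix:
  assumes "length (v s) \<le> L"
  shows "map (\<lambda>j. place_words a L v (int L * s + int j)) [0..<length (v s)] = v s"
  using assms by (intro nth_equalityI) (auto simp: place_words_at)

lemma map_place_words_block:
  assumes "length (v s) \<le> L"
  shows "map (\<lambda>j. place_words a L v (int L * s + int j)) [0..<L] =
    v s @ replicate (L - length (v s)) a"
  using assms by (intro nth_equalityI) (auto simp: place_words_at nth_append)

lemma map_upt_add:
  "map (\<lambda>j. x (i + int j)) [0..<n + n'] =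
    map (\<lambda>j. x (i + int j)) [0..<n] @ map (\<lambda>j. x (i + int n + int j)) [0..<n']"
  by (intro nth_equalityI) (auto simp: nth_append algebra_simps)

text \<open>Reading starts at block 1, not 0, to match the numbering of words in
  \<open>strong_property_P\<close>.\<close>

lemma map_place_words_blocks:
  assumes "\<And>s. length (v s) \<le> L"
  shows "map (\<lambda>j. place_words a L v (int L + int j)) [0..<N * L] =
    concat (map (\<lambda>i. v (int i) @ replicate (L - length (v (int i))) a) [1..<Suc N])"
proof (induction N)
  case (Suc N)
  have "int L + int (N * L) = int L * int (Suc N)"
    by (simp add: algebra_simps)
  with Suc show ?case
    using map_upt_add[of "place_words a L v" "int L" "N * L" L]
      map_place_words_block[where s = "int (Suc N)", OF assms, of a]
    by (simp add: add.commute)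
qed simp

text \<open>Stopping at the end of the last word, before its filler, gives the form required by
  \<open>strong_property_P\<close> and, with two words, by transitivity.\<close>

lemma place_words_word_in_language:
  assumes "a \<noteq> b"
    and "\<And>s. v s \<in> language (spacing_shift a b)"
    and "\<And>s. length (v s) \<le> m"
    and "1 \<le> N"
  shows "concat (map (\<lambda>i. v (int i) @ replicate (2 * 3 ^ m - length (v (int i))) a) [1..<N])
    @ v (int N) \<in> language (spacing_shift a b)"
proof -
  define L :: nat where "L = 2 * 3 ^ m"
  let ?x = "place_words a L v"
  have len: "length (v s) \<le> L" for s
    using assms(3)[of s] less_three_power[of m] by (simp add: L_def)
  obtain M where N: "N = Suc M"
    using \<open>1 \<le> N\<close> by (cases N) auto
  have "int L + int (M * L) = int L * int N"
    by (simp add: N algebra_simps)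
  then have "map (\<lambda>j. ?x (int L + int j)) [0..<M * L + length (v (int N))] =
      concat (map (\<lambda>i. v (int i) @ replicate (L - length (v (int i))) a) [1..<N]) @ v (int N)"
    using map_upt_add[of ?x "int L" "M * L" "length (v (int N))"]
      map_place_words_blocks[where v = v, OF len, of a M]
      map_place_words_prefix[where v = v and s = "int N", OF len, of a]
    by (simp add: N)
  moreover have "?x \<in> spacing_shift a b"
    unfolding L_def by (rule place_words_in_spacing_shift) (use assms in auto)
  ultimately show ?thesis
    using map_in_languageI[of ?x] by (metis L_def)
qed

section \<open>Transitivity, the strong property \<open>P\<close> and failure of mixing\<close>

lemma transitive_spacing_shift:
  assumes "a \<noteq> b"
  shows "transitive_shift (spacing_shift a b)"
  unfolding transitive_shift_def
proof (intro ballI bexI)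
  fix u v
  assume uv: "u \<in> language (spacing_shift a b)" "v \<in> language (spacing_shift a b)"
  define m where "m = max (length u) (length v)"
  \<comment> \<open>Only blocks 1 and 2 are read; repeating \<open>v\<close> elsewhere keeps all
    blocks in the language and of length at most \<open>m\<close>.\<close>
  let ?v = "\<lambda>s::int. if s = 1 then u else v"
  have "concat (map (\<lambda>i. ?v (int i) @ replicate (2 * 3 ^ m - length (?v (int i))) a) [1..<2])
    @ ?v (int 2) \<in> language (spacing_shift a b)"
    by (rule place_words_word_in_language) (use assms uv in \<open>auto simp: m_def\<close>)
  moreover have "[1..<2] = [1::nat]"
    by (simp add: numeral_2_eq_2)
  ultimately show "u @ replicate (2 * 3 ^ m - length u) a @ v \<in> language (spacing_shift a b)"
    by simp
qed (rule replicate_in_language_spacing_shift[OF assms])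

text \<open>The gap length depends only on the common length of the words, hence serves every
  \<open>N\<close> and \<open>\<phi>\<close>.\<close>

lemma strong_property_P_spacing_shift:
  assumes "a \<noteq> b"
  shows "strong_property_P (spacing_shift a b)"
  unfolding strong_property_P_def
proof (intro allI impI)
  fix k :: nat and u :: "nat \<Rightarrow> 'a list"
  assume "2 \<le> k" and u_lang_len: "(\<forall>i\<in>{1..k}. u i \<in> language (spacing_shift a b)) \<and>
    (\<forall>i\<in>{1..k}. \<forall>j\<in>{1..k}. length (u i) = length (u j))"
  define m where "m = length (u 1)"
  have "1 \<in> {1..k}"
    using \<open>2 \<le> k\<close> by simp
  then have u: "u i \<in> language (spacing_shift a b)" "length (u i) = m" if "i \<in> {1..k}" for i
    unfolding m_def using u_lang_len that by blast+
  \<comment> \<open>A gap of this length completes a word of length \<open>m\<close> to a full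
    block.\<close>
  define n where "n = 2 * 3 ^ m - m"
  show "\<exists>n\<ge>1. \<forall>N\<ge>1. \<forall>\<phi> \<in> {1..N} \<rightarrow> {1..k}.
           \<exists>w. (\<forall>i\<in>{1..<N}. w i \<in> language_of_length (spacing_shift a b) n) \<and>
               concat (map (\<lambda>i. u (\<phi> i) @ w i) [1..<N]) @ u (\<phi> N) \<in> language (spacing_shift a b)"
  proof (intro exI[of _ n] conjI allI impI ballI)
    show "1 \<le> n"
      using less_three_power[of m] by (simp add: n_def)
    fix N :: nat and \<phi> :: "nat \<Rightarrow> nat"
    assume N: "1 \<le> N" and \<phi>: "\<phi> \<in> {1..N} \<rightarrow> {1..k}"
    have u\<phi>: "u (\<phi> i) \<in> language (spacing_shift a b)" "length (u (\<phi> i)) = m"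
      if "i \<in> {1..N}" for i
      using u[OF funcset_mem[OF \<phi> that]] .
    have nat_in: "nat s \<in> {1..N}" if "s \<in> {1..int N}" for s
      using that by auto
    \<comment> \<open>Outside \<open>1..N\<close> nothing is known about \<open>\<phi>\<close>, so
      those blocks are left empty.\<close>
    let ?v = "\<lambda>s. if s \<in> {1..int N} then u (\<phi> (nat s)) else []"
    have "[] \<in> language (spacing_shift a b)"
      using replicate_in_language_spacing_shift[OF assms, of 0] by simp
    then have "concat (map (\<lambda>i. ?v (int i) @ replicate (2 * 3 ^ m - length (?v (int i))) a) [1..<N])
        @ ?v (int N) \<in> language (spacing_shift a b)"
      by (intro place_words_word_in_language assms N)
        (simp_all add: u\<phi>[OF nat_in] del: atLeastAtMost_iff)
    moreover have "map (\<lambda>i. ?v (int i) @ replicate (2 * 3 ^ m - length (?v (int i))) a) [1..<N] =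
        map (\<lambda>i. u (\<phi> i) @ replicate n a) [1..<N]"
      using u\<phi>(2) by (intro map_cong) (auto simp: n_def)
    moreover have "?v (int N) = u (\<phi> N)"
      using N by simp
    ultimately have "concat (map (\<lambda>i. u (\<phi> i) @ replicate n a) [1..<N]) @ u (\<phi> N)
        \<in> language (spacing_shift a b)"
      by (simp only:)
    then show "\<exists>w. (\<forall>i\<in>{1..<N}. w i \<in> language_of_length (spacing_shift a b) n) \<and>
        concat (map (\<lambda>i. u (\<phi> i) @ w i) [1..<N]) @ u (\<phi> N) \<in> language (spacing_shift a b)"
      using replicate_in_language_spacing_shift[OF assms, of n]
      by (intro exI[of _ "\<lambda>_. replicate n a"]) (simp add: language_of_length_def)
  qed
qed

text \<open>A word of length \<open>3 ^ k - 1\<close> between two symbols \<open>b\<close> puts them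
  at distance \<open>3 ^ k\<close>, and such lengths are unbounded.\<close>

lemma not_mixing_spacing_shift:
  assumes "a \<noteq> b"
  shows "\<not> mixing_shift (spacing_shift a b)"
proof
  assume mix: "mixing_shift (spacing_shift a b)"
  have "(\<lambda>i. if i = 0 then b else a) \<in> spacing_shift a b"
    using assms by (auto simp: spacing_shift_def)
  from map_in_languageI[OF this, of 0 1] have "[b] \<in> language (spacing_shift a b)"
    by simp
  with mix obtain N where N: "\<And>n. n > N \<Longrightarrow>
      \<exists>w \<in> language_of_length (spacing_shift a b) n. [b] @ w @ [b] \<in> language (spacing_shift a b)"
    unfolding mixing_shift_def by blast
  \<comment> \<open>The exponent \<open>Suc N\<close> is a safe choice: with exponent
    \<open>N\<close> the strict inequality fails at \<open>N = 0\<close>.\<close>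
  have "N < 3 ^ Suc N - 1"
    using less_three_power[of N] by simp
  from N[OF this] obtain w where w: "length w = 3 ^ Suc N - 1"
      "[b] @ w @ [b] \<in> language (spacing_shift a b)"
    by (auto simp: language_of_length_def)
  then have "3 ^ Suc N = Suc (length w)"
    by simp
  then show False
    using language_spacing_shiftD(2)[OF w(2), of 0 "Suc N"] by (simp del: power_Suc)
qed

theorem theorem4p1:
  fixes A :: "'a set"
  assumes "finite A" and "card A \<ge> 2"
  shows "\<exists>Y. shift_space A Y \<and> transitive_shift Y \<and> \<not> mixing_shift Y \<and> strong_property_P Y"
proof -
  obtain a b where "a \<in> A" "b \<in> A" "a \<noteq> b"
    using assms(2) by (metis card_le_Suc0_iff_eq assms(1) not_less_eq_eq numeral_2_eq_2)
  then show ?thesis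
    using shift_space_spacing_shift transitive_spacing_shift not_mixing_spacing_shift
      strong_property_P_spacing_shift by metis
qed

end
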